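(* Let $A$ be a totally ordered alphabet, let $u,v$ be nonempty finite words over $A$ such that $u^\omega\neq v^\omega$, and let $s,t$ be infinite words belonging to $\{u,v\}^\omega$ (i.e. each of $s,t$ is an infinite concatenation of copies of $u$ and $v$). Then $u^\omega<v^\omega$ if and only if $us<vt$.
   Context: The order $<$ on finite and infinite words is the lexicographical order induced by the order of $A$: $s<t$ if either $s$ is a proper prefix of $t$, or $s=pas'$, $t=pbt'$ with $p$ finite, $a,b$ letters with $a<b$. For a nonempty finite word $w$, $w^\omega=www\cdots$. *)

theory Defs
  imports "HOL-Library.Stream"
begin

(* Infinite words are streams: cycle w is the infinite power of a nonempty word w, and
   u @- s is the concatenation of a finite word u with an infinite word s. *)

(* An infinite word is never a proper prefix of anything, so on infinite words only the
   clause about the first differing letter of the lexicographical order applies. *)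
definition less_word :: "'a::linorder stream \<Rightarrow> 'a stream \<Rightarrow> bool"  (infix "\<prec>" 50) where
  "s \<prec> t \<longleftrightarrow>
    (\<exists>p a b s' t'. s = p @- (a ## s') \<and> t = p @- (b ## t') \<and> a < b)"

(* The infinite concatenations of words of X. Meaningful only when [] is not in X, since
   flat concatenates a stream of lists only if all of them are nonempty. *)
definition omega_language :: "'a list set \<Rightarrow> 'a stream set" where
  "omega_language X = {flat ws | ws. ws \<in> streams X}"

end

(* If u and v are not prefix-comparable, their first mismatch decides every comparison.  If v = uw,
   cancel the common prefix u: as every word of {u, uw}^omega begins with u, the comparison of us
   with vt becomes one of us'' with wt, where s'' and t are words over {u, w} and again u and w
   have different infinite powers.  By induction on |u| + |v|, the order of us and vt does not
   depend on s and t; the choice s = u^omega, t = v^omega identifies it. *)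

theory Submission
  imports Defs "HOL-Library.Sublist"
begin

text \<open>Locating the mismatch by an index lets two mismatches be compared by position, as
  asymmetry requires.\<close>

lemma less_word_iff_snth:
  "s \<prec> t \<longleftrightarrow> (\<exists>n. stake n s = stake n t \<and> s !! n < t !! n)"
proof
  assume "s \<prec> t"
  then obtain p a b s' t' where "s = p @- (a ## s')" "t = p @- (b ## t')" "a < b"
    unfolding less_word_def by blast
  then have "stake (length p) s = stake (length p) t \<and> s !! length p < t !! length p"
    by (simp add: stake_shift)
  then show "\<exists>n. stake n s = stake n t \<and> s !! n < t !! n" ..
next
  assume "\<exists>n. stake n s = stake n t \<and> s !! n < t !! n"
  then obtain n where n: "stake n s = stake n t" "s !! n < t !! n" by blast
  have "x = stake n x @- (x !! n ## sdrop (Suc n) x)" for x :: "'a stream"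
    by (metis id_stake_snth_sdrop)
  with n show "s \<prec> t" unfolding less_word_def by metis
qed

lemma less_word_asym:
  assumes "s \<prec> t" shows "\<not> t \<prec> s"
proof
  assume "t \<prec> s"
  then obtain m where m: "stake m t = stake m s" "t !! m < s !! m"
    unfolding less_word_iff_snth by blast
  obtain n where n: "stake n s = stake n t" "s !! n < t !! n"
    using assms unfolding less_word_iff_snth by blast
  have eq: "s !! i = t !! i" if "stake k s = stake k t" "i < k" for i k
    using that by (metis stake_nth)
  consider "m < n" | "m = n" | "n < m" by linarith
  then show False
    using m n eq[of n m] eq[of m n] by cases auto
qed

lemma less_word_shift: "s \<prec> t \<Longrightarrow> u @- s \<prec> u @- t"
  unfolding less_word_def by (metis shift_append)

lemma less_word_mismatch:
  "a < b \<Longrightarrow> (p @ a # us) @- s \<prec> (p @ b # vs) @- t"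
  unfolding less_word_def by auto

lemma cycle_unique:
  assumes "v \<noteq> []" and "s = v @- s" shows "s = cycle v"
  using assms
proof (coinduction arbitrary: s v)
  case Eq_stream
  then have "shd s = hd v" and stl: "stl s = tl v @- s"
    by (metis shift_simps(1), metis shift_simps(2))
  \<comment> \<open>The tail satisfies the same fixed-point equation for the rotated word, so the
    coinduction has to let \<open>v\<close> vary.\<close>
  then have "stl s = (tl v @ [hd v]) @- stl s"
    by (metis shift.simps shift_append stream.collapse)
  then show ?case
    using \<open>shd s = hd v\<close> by (auto intro!: exI[of _ "tl v @ [hd v]"])
qed

text \<open>The common power absorbs \<open>w\<close> and then \<open>u\<close> in front, so it is
  fixed under prepending \<open>u @ w\<close>. Used contrapositively, to keep the infinite powers
  distinct when \<open>u @ w\<close> is replaced by \<open>w\<close>.\<close>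

lemma cycle_append_eq:
  assumes "u \<noteq> []" and "w \<noteq> []" and eq: "cycle u = cycle w"
  shows "cycle u = cycle (u @ w)"
proof (rule cycle_unique)
  have "(u @ w) @- cycle u = u @- (w @- cycle w)" by (simp add: eq)
  also have "\<dots> = cycle u"
    using assms by (metis cycle_decomp)
  finally show "cycle u = (u @ w) @- cycle u" ..
qed (use assms in simp)

text \<open>For nonempty \<open>u\<close> and \<open>v\<close>, iterating this condition parses each
  word of \<open>X\<close> completely into copies of \<open>u\<close> and \<open>v\<close>. As a
  closure property of \<open>X\<close> it is easy to carry through an induction that changes the
  pair of words.\<close>

definition factorizable :: "'a list \<Rightarrow> 'a list \<Rightarrow> 'a stream set \<Rightarrow> bool" where
  "factorizable u v X \<longleftrightarrow> (\<forall>x\<in>X. \<exists>y\<in>X. x = u @- y \<or> x = v @- y)"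

lemma factorizable_commute: "factorizable u v X \<longleftrightarrow> factorizable v u X"
  unfolding factorizable_def by blast

lemma factorizable_omega_language:
  assumes "u \<noteq> []" and "v \<noteq> []"
  shows "factorizable u v (omega_language {u, v})"
  unfolding factorizable_def
proof
  fix x assume "x \<in> omega_language {u, v}"
  then obtain ws where ws: "x = flat ws" "ws \<in> streams {u, v}"
    unfolding omega_language_def by blast
  then have "shd ws \<in> {u, v}" "stl ws \<in> streams {u, v}"
    by (auto elim: streams.cases)
  moreover from this have "x = shd ws @- flat (stl ws)"
    using ws assms by (auto simp: flat_unfold)
  ultimately show "\<exists>y\<in>omega_language {u, v}. x = u @- y \<or> x = v @- y"
    unfolding omega_language_def by blast
qed

lemma factorizable_extend:
  assumes "factorizable u (u @ w) X"
  shows "factorizable u w (X \<union> (@-) w ` X)"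
  using assms unfolding factorizable_def by fastforce

lemma comparison_uniform:
  fixes u v :: "'a::linorder list"
  assumes "u \<noteq> []" and "v \<noteq> []" and "cycle u \<noteq> cycle v" and "factorizable u v X"
  shows "(\<forall>s\<in>X. \<forall>t\<in>X. u @- s \<prec> v @- t) \<or> (\<forall>s\<in>X. \<forall>t\<in>X. v @- t \<prec> u @- s)"
  using assms
proof (induction "length u + length v" arbitrary: u v X rule: less_induct)
  case less
  \<comment> \<open>Stated for fresh \<open>x\<close> and \<open>y\<close> so that it serves both
    directions of prefix comparability.\<close>
  have prefix_case:
    "(\<forall>s\<in>X. \<forall>t\<in>X. x @- s \<prec> y @- t) \<or> (\<forall>s\<in>X. \<forall>t\<in>X. y @- t \<prec> x @- s)"
    if "length x + length y = length u + length v" "x \<noteq> []" "cycle x \<noteq> cycle y"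
      "factorizable x y X" "prefix x y" for x y
  proof -
    obtain w where y: "y = x @ w" using \<open>prefix x y\<close> by (auto simp: prefix_def)
    then have "w \<noteq> []" using that(3) by auto
    then have "cycle x \<noteq> cycle w" using cycle_append_eq that(2,3) y by metis
    define Y where "Y = X \<union> (@-) w ` X"
    have "factorizable x w Y"
      using factorizable_extend that(4) unfolding y Y_def by blast
    moreover have "length x + length w < length u + length v"
      using that(1,2) y by (cases x) auto
    ultimately have IH: "(\<forall>s\<in>Y. \<forall>t\<in>Y. x @- s \<prec> w @- t) \<or> (\<forall>s\<in>Y. \<forall>t\<in>Y. w @- t \<prec> x @- s)"
      using less.hyps that(2) \<open>w \<noteq> []\<close> \<open>cycle x \<noteq> cycle w\<close> by blast
    have "X \<subseteq> Y" by (simp add: Y_def)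
    \<comment> \<open>Both possible first factors, \<open>x\<close> and \<open>x @ w\<close>, begin
      with \<open>x\<close>. Putting this \<open>s'\<close> into \<open>IH\<close> turns
      \<open>x @- s'\<close> into \<open>s\<close>.\<close>
    moreover have "\<exists>s'\<in>Y. s = x @- s'" if "s \<in> X" for s
      using \<open>factorizable x y X\<close> that unfolding factorizable_def y Y_def by fastforce
    ultimately have "(\<forall>s\<in>X. \<forall>t\<in>X. s \<prec> w @- t) \<or> (\<forall>s\<in>X. \<forall>t\<in>X. w @- t \<prec> s)"
      using IH by (metis subsetD)
    then show ?thesis
      unfolding y by (auto intro: less_word_shift)
  qed
  consider "prefix u v" | "prefix v u" | "u \<parallel> v" by blast
  then show ?case
  proof cases
    case 1
    then show ?thesis using prefix_case[of u v] less.prems by simp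
  next
    case 2
    then show ?thesis
      using prefix_case[of v u] less.prems factorizable_commute[of u v] by (auto simp: add.commute)
  next
    case 3
    then obtain p a us b vs where "a \<noteq> b" "u = p @ a # us" "v = p @ b # vs"
      using parallel_decomp by blast
    then show ?thesis
      using less_word_mismatch by (metis linorder_neqE)
  qed
qed

theorem theorem1:
  fixes u v :: "'a::linorder list" and s t :: "'a stream"
  assumes "u \<noteq> []" and "v \<noteq> []"
    and "cycle u \<noteq> cycle v"
    and "s \<in> omega_language {u, v}" and "t \<in> omega_language {u, v}"
  shows "cycle u \<prec> cycle v \<longleftrightarrow> u @- s \<prec> v @- t"
proof -
  have dec: "cycle u = u @- cycle u" "cycle v = v @- cycle v"
    using cycle_decomp assms(1,2) by blast+
  \<comment> \<open>The two powers are added so that the uniform comparison can be evaluated at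
    them; each reproduces itself once a copy of its word is removed.\<close>
  define X where "X = omega_language {u, v} \<union> {cycle u, cycle v}"
  have "factorizable u v X"
    using factorizable_omega_language[OF assms(1,2)] dec unfolding factorizable_def X_def by blast
  then have "(\<forall>s\<in>X. \<forall>t\<in>X. u @- s \<prec> v @- t) \<or> (\<forall>s\<in>X. \<forall>t\<in>X. v @- t \<prec> u @- s)"
    using comparison_uniform assms(1-3) by blast
  moreover have "s \<in> X" "t \<in> X" "cycle u \<in> X" "cycle v \<in> X"
    using assms(4,5) by (simp_all add: X_def)
  ultimately have "u @- cycle u \<prec> v @- cycle v \<and> u @- s \<prec> v @- t \<or>
      v @- cycle v \<prec> u @- cycle u \<and> v @- t \<prec> u @- s"
    by blast
  then have "cycle u \<prec> cycle v \<and> u @- s \<prec> v @- t \<or>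
      cycle v \<prec> cycle u \<and> v @- t \<prec> u @- s"
    by (simp only: dec[symmetric])
  \<comment> \<open>Asymmetry excludes the mixed cases, so the two alternatives amount to the
    equivalence.\<close>
  then show ?thesis using less_word_asym by blast
qed

end
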